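(* Let $(V,\omega)$ be a symplectic real vector space of dimension $2n$ with a fixed basis. The Lie algebra $\mathfrak{sp}_{\omega}(n;\mathbb{R})$ of the $\omega$-symplectic group $Sp_{\omega}(n;\mathbb{R})$ satisfies $$\mathfrak{sp}_{\omega}(n;\mathbb{R})=\left\{L\in\mathbb{M}_{2n}(\mathbb{R}): L^T[\omega]+[\omega]L=0\right\}=\left\{L\in\mathbb{M}_{2n}(\mathbb{R}): ([\omega]^{-1})^TL^T[\omega]=L\right\}.$$
   Context: A symplectic vector space $(V,\omega)$ is a finite-dimensional real vector space $V$ (of even dimension $2n$) with an alternating non-degenerate bilinear form $\omega:V\times V\to\mathbb{R}$. A (not necessarily symplectic) basis of $V$ is fixed and $[\omega]\in\mathbb{M}_{2n}(\mathbb{R})$ is the (skew-symmetric, invertible) matrix of $\omega$ in this basis, so $\omega(\mathbf u,\mathbf v)=\mathbf u^T[\omega]\mathbf v$ in coordinates. The $\omega$-symplectic group is the closed subgroup $Sp_{\omega}(n;\mathbb{R})=\{B\in GL(2n): B^T[\omega]B=[\omega]\}$ of the group $GL(2n)$ of invertible real $2n\times 2n$ matrices. Its Lie algebra is $\mathfrak{sp}_{\omega}(n;\mathbb{R})=\{L\in\mathbb{M}_{2n}(\mathbb{R}): \exp(tL)\in Sp_{\omega}(n;\mathbb{R})\ \text{for all } t\in\mathbb{R}\}$. *)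

theory Defs
  imports "HOL-Analysis.Analysis"
begin

definition symplectic_form :: "('v::real_vector \<Rightarrow> 'v \<Rightarrow> real) \<Rightarrow> bool" where
  "symplectic_form \<omega> \<longleftrightarrow>
     bilinear \<omega> \<and> (\<forall>u. \<omega> u u = 0) \<and> (\<forall>u. (\<forall>v. \<omega> u v = 0) \<longrightarrow> u = 0)"

text \<open>A basis is a family, so that it fixes the rows and columns of matrices. As the index type is
  finite, the existence of such a family forces the ambient space to be finite-dimensional.\<close>

definition indexed_basis :: "('n::finite \<Rightarrow> 'v::real_vector) \<Rightarrow> bool" where
  "indexed_basis b \<longleftrightarrow> inj b \<and> independent (range b) \<and> span (range b) = UNIV"

definition form_matrix ::
    "('v \<Rightarrow> 'v \<Rightarrow> real) \<Rightarrow> ('n \<Rightarrow> 'v) \<Rightarrow> real ^ 'n ^ 'n::finite" where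
  "form_matrix \<omega> b = (\<chi> i j. \<omega> (b i) (b j))"

definition general_linear_group :: "(real ^ 'n ^ 'n::finite) set" where
  "general_linear_group = {B. invertible B}"

definition symplectic_group ::
    "('v \<Rightarrow> 'v \<Rightarrow> real) \<Rightarrow> ('n \<Rightarrow> 'v) \<Rightarrow> (real ^ 'n ^ 'n::finite) set" where
  "symplectic_group \<omega> b =
     {B \<in> general_linear_group. transpose B ** form_matrix \<omega> b ** B = form_matrix \<omega> b}"

text \<open>The library's multiplication and \<^const>\<open>exp\<close> do not provide the matrix exponential here: \<open>*\<close>
  on \<open>real ^ 'n ^ 'n\<close> is componentwise. The power series is therefore written with \<open>**\<close>; it
  converges for every matrix by \<open>summable_matrix_exp\<close> below.\<close>

definition matrix_power :: "real ^ 'n ^ 'n \<Rightarrow> nat \<Rightarrow> real ^ 'n ^ 'n::finite" where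
  "matrix_power A k = (((**) A) ^^ k) (mat 1)"

definition matrix_exp :: "real ^ 'n ^ 'n \<Rightarrow> real ^ 'n ^ 'n::finite" where
  "matrix_exp A = (\<Sum>k. (1 / fact k) *\<^sub>R matrix_power A k)"

definition matrix_lie_algebra :: "(real ^ 'n ^ 'n::finite) set \<Rightarrow> (real ^ 'n ^ 'n) set" where
  "matrix_lie_algebra G = {L. \<forall>t::real. matrix_exp (t *\<^sub>R L) \<in> G}"

definition symplectic_lie_algebra ::
    "('v \<Rightarrow> 'v \<Rightarrow> real) \<Rightarrow> ('n \<Rightarrow> 'v) \<Rightarrow> (real ^ 'n ^ 'n::finite) set" where
  "symplectic_lie_algebra \<omega> b = matrix_lie_algebra (symplectic_group \<omega> b)"

lemma matrix_power_entry_bound: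
  fixes A :: "real ^ 'n ^ 'n::finite"
  shows "\<bar>matrix_power A k $ i $ j\<bar> \<le> (\<Sum>i\<in>UNIV. \<Sum>j\<in>UNIV. \<bar>A $ i $ j\<bar>) ^ k"
proof (induction k arbitrary: i)
  case 0
  show ?case by (simp add: matrix_power_def mat_def)
next
  case (Suc k)
  let ?K = "\<Sum>i\<in>UNIV. \<Sum>j\<in>UNIV. \<bar>A $ i $ j\<bar>"
  have K: "0 \<le> ?K" by (intro sum_nonneg) auto
  have "\<bar>matrix_power A (Suc k) $ i $ j\<bar> = \<bar>\<Sum>l\<in>UNIV. A $ i $ l * matrix_power A k $ l $ j\<bar>"
    by (simp add: matrix_power_def matrix_matrix_mult_def)
  also have "\<dots> \<le> (\<Sum>l\<in>UNIV. \<bar>A $ i $ l\<bar> * \<bar>matrix_power A k $ l $ j\<bar>)"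
    by (rule order_trans[OF sum_abs]) (simp add: abs_mult)
  also have "\<dots> \<le> (\<Sum>l\<in>UNIV. \<bar>A $ i $ l\<bar> * ?K ^ k)"
    by (intro sum_mono mult_left_mono Suc.IH) auto
  also have "\<dots> = (\<Sum>l\<in>UNIV. \<bar>A $ i $ l\<bar>) * ?K ^ k"
    by (simp add: sum_distrib_right)
  also have "\<dots> \<le> ?K * ?K ^ k"
    by (intro mult_right_mono zero_le_power K member_le_sum[of i UNIV "\<lambda>i. \<Sum>j\<in>UNIV. \<bar>A $ i $ j\<bar>"] sum_nonneg) auto
  finally show ?case by simp
qed

lemma summable_matrix_exp:
  fixes A :: "real ^ 'n ^ 'n::finite"
  shows "summable (\<lambda>k. (1 / fact k) *\<^sub>R matrix_power A k)"
proof (rule summable_comparison_test')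
  let ?K = "\<Sum>i\<in>UNIV. \<Sum>j\<in>UNIV. \<bar>A $ i $ j\<bar>"
  let ?N = "real CARD('n)"
  show "summable (\<lambda>k. ?N * ?N * (inverse (fact k) * ?K ^ k))"
    by (intro summable_mult summable_exp)
  fix k :: nat
  have "norm (matrix_power A k) \<le> (\<Sum>i\<in>UNIV. norm (matrix_power A k $ i))"
    unfolding norm_vec_def[of "matrix_power A k"] by (rule L2_set_le_sum) simp
  also have "\<dots> \<le> (\<Sum>i::'n\<in>UNIV. \<Sum>j::'n\<in>UNIV. ?K ^ k)"
    by (intro sum_mono order_trans[OF norm_le_l1_cart] matrix_power_entry_bound)
  also have "\<dots> = ?N * ?N * ?K ^ k" by simp
  finally show "norm ((1 / fact k) *\<^sub>R matrix_power A k) \<le> ?N * ?N * (inverse (fact k) * ?K ^ k)"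
    by (simp add: field_simps)
qed

end

theory Submission
  imports Defs
begin

text \<open>With \<open>\<Omega> = [\<omega>]\<close> and \<open>E t = exp (t L)\<close>, the curve \<open>F t = (E t)\<^sup>T \<Omega> (E t)\<close> satisfies
  \<open>F 0 = \<Omega>\<close> and, since \<open>E' = L E\<close>, has derivative \<open>(E t)\<^sup>T (L\<^sup>T \<Omega> + \<Omega> L) (E t)\<close>. Hence \<open>F\<close> is constant
  if and only if \<open>L\<^sup>T \<Omega> + \<Omega> L = 0\<close>. The second description of the algebra follows by
  multiplying with \<open>\<Omega>\<^sup>-\<^sup>1\<close>, because \<open>\<Omega>\<^sup>T = -\<Omega>\<close>.\<close>

text \<open>In finite dimension bilinearity already gives boundedness. The bounded form is what the
  product rule for matrix-valued curves asks for.\<close>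

lemma bounded_bilinear_matrix_mult:
  "bounded_bilinear ((**) :: real ^ 'n ^ 'm \<Rightarrow> real ^ 'p ^ 'n \<Rightarrow> real ^ 'p ^ 'm)"
proof -
  have "bilinear ((**) :: real ^ 'n ^ 'm \<Rightarrow> real ^ 'p ^ 'n \<Rightarrow> real ^ 'p ^ 'm)"
    by (auto simp: bilinear_def linear_iff matrix_matrix_mult_def vec_eq_iff sum.distrib
        sum_distrib_left algebra_simps)
  then show ?thesis
    by (simp add: bilinear_conv_bounded_bilinear)
qed

lemma bounded_linear_transpose: "bounded_linear (transpose :: real ^ 'n ^ 'm \<Rightarrow> real ^ 'm ^ 'n)"
proof -
  have "linear (transpose :: real ^ 'n ^ 'm \<Rightarrow> real ^ 'm ^ 'n)"
    by (simp add: linear_iff transpose_def vec_eq_iff)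
  then show ?thesis
    by (rule linear_conv_bounded_linear[THEN iffD1])
qed

text \<open>Every basis vector is some \<open>axis i u\<close>, and the inner product with it only
  sees component \<open>i\<close>. Applied twice to a matrix, first to rows and then to entries, the
  rule reduces differentiation to real-valued functions.\<close>

lemma has_vector_derivative_vecI:
  fixes f :: "real \<Rightarrow> 'a::euclidean_space ^ 'n"
  assumes "\<And>i. ((\<lambda>t. f t $ i) has_vector_derivative f' $ i) (at t within S)"
  shows "(f has_vector_derivative f') (at t within S)"
  unfolding has_vector_derivative_def
proof (subst has_derivative_componentwise_within, rule ballI)
  fix v :: "'a ^ 'n"
  assume "v \<in> Basis"
  then obtain i u where v: "v = axis i u"
    by (auto simp: Basis_vec_def)
  have "((\<lambda>s. f s $ i \<bullet> u) has_derivative (\<lambda>h. h *\<^sub>R f' $ i \<bullet> u)) (at t within S)"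
    using assms[of i] unfolding has_vector_derivative_def
    by (rule has_derivative_inner_left)
  then show "((\<lambda>s. f s \<bullet> v) has_derivative (\<lambda>h. h *\<^sub>R f' \<bullet> v)) (at t within S)"
    by (simp add: v inner_axis)
qed

lemma matrix_power_0 [simp]: "matrix_power A 0 = mat 1"
  by (simp add: matrix_power_def)

lemma matrix_power_Suc [simp]: "matrix_power A (Suc k) = A ** matrix_power A k"
  by (simp add: matrix_power_def)

lemma matrix_power_scaleR: "matrix_power (t *\<^sub>R A) k = t ^ k *\<^sub>R matrix_power A k"
proof (induction k)
  case (Suc k)
  have "(t *\<^sub>R A) ** (t ^ k *\<^sub>R matrix_power A k) =
      t *\<^sub>R (t ^ k *\<^sub>R (A ** matrix_power A k))"
    by (metis matrix_scalar_ac scalar_matrix_assoc)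
  then show ?case
    unfolding matrix_power_Suc Suc by simp
qed simp

lemma matrix_exp_0 [simp]: "matrix_exp 0 = mat 1"
proof -
  have "(1 / fact k) *\<^sub>R matrix_power 0 k = 0" if "k \<notin> {0}" for k :: nat
    using that by (cases k) simp_all
  then show ?thesis
    unfolding matrix_exp_def by (subst suminf_finite[of "{0}"]) auto
qed

text \<open>Taking entries of the exponential series leaves an ordinary real power series in
  \<open>t\<close>, to which termwise differentiation applies.\<close>

lemma matrix_exp_entry_sums:
  "(\<lambda>k. matrix_power A k $ i $ j / fact k * t ^ k) sums (matrix_exp (t *\<^sub>R A) $ i $ j)"
proof -
  have "(\<lambda>k. (1 / fact k) *\<^sub>R matrix_power (t *\<^sub>R A) k) sums matrix_exp (t *\<^sub>R A)"
    unfolding matrix_exp_def by (rule summable_sums[OF summable_matrix_exp])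
  from sums_vec_nth[OF sums_vec_nth[OF this, of i], of j] show ?thesis
    by (simp add: matrix_power_scaleR mult_ac)
qed

lemma matrix_exp_has_vector_derivative:
  "((\<lambda>t. matrix_exp (t *\<^sub>R A)) has_vector_derivative A ** matrix_exp (t *\<^sub>R A)) (at t within S)"
proof (intro has_vector_derivative_vecI)
  fix i j
  define c where "c = (\<lambda>k. matrix_power A k $ i $ j / fact k)"
  have c: "(\<lambda>k. c k * s ^ k) sums (matrix_exp (s *\<^sub>R A) $ i $ j)" for s
    unfolding c_def by (rule matrix_exp_entry_sums)
  have "diffs c k = (\<Sum>l\<in>UNIV. A $ i $ l * (matrix_power A k $ l $ j / fact k))" for k
  proof -
    \<comment> \<open>The factor \<open>Suc k\<close> produced by differentiation cancels against
      \<open>fact (Suc k)\<close>; keeping \<open>of_nat (Suc k)\<close> unexpanded lets the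
      simplifier see this.\<close>
    have "diffs c k = (A ** matrix_power A k) $ i $ j / fact k"
      by (simp add: diffs_def c_def del: of_nat_Suc)
    then show ?thesis
      by (simp add: matrix_matrix_mult_def sum_divide_distrib)
  qed
  then have "(\<lambda>k. diffs c k * t ^ k) =
      (\<lambda>k. \<Sum>l\<in>UNIV. A $ i $ l * (matrix_power A k $ l $ j / fact k * t ^ k))"
    by (simp add: sum_distrib_right mult.assoc)
  moreover have "(\<lambda>k. \<Sum>l\<in>UNIV. A $ i $ l * (matrix_power A k $ l $ j / fact k * t ^ k)) sums
      (\<Sum>l\<in>UNIV. A $ i $ l * matrix_exp (t *\<^sub>R A) $ l $ j)"
    by (intro sums_sum sums_mult matrix_exp_entry_sums)
  ultimately have "(\<Sum>k. diffs c k * t ^ k) = (A ** matrix_exp (t *\<^sub>R A)) $ i $ j"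
    by (simp add: sums_iff matrix_matrix_mult_def)
  \<comment> \<open>The series converges for every real argument, so no radius of convergence has to
    be tracked.\<close>
  moreover have "((\<lambda>s. \<Sum>k. c k * s ^ k) has_field_derivative (\<Sum>k. diffs c k * t ^ k)) (at t)"
    using c by (intro termdiffs_strong_converges_everywhere) (blast intro: sums_summable)
  moreover have "(\<lambda>s. \<Sum>k. c k * s ^ k) = (\<lambda>s. matrix_exp (s *\<^sub>R A) $ i $ j)"
    using c by (simp add: sums_iff)
  ultimately show "((\<lambda>s. matrix_exp (s *\<^sub>R A) $ i $ j) has_vector_derivative
      (A ** matrix_exp (t *\<^sub>R A)) $ i $ j) (at t within S)"
    by (simp add: has_real_derivative_iff_has_vector_derivative has_vector_derivative_at_within)
qed

text \<open>Since \<open>E' = L ** E\<close>, transposing gives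
  \<open>transpose E ** transpose L\<close> as the derivative of the left factor. Hence in both
  terms of the product rule the factor coming from \<open>L\<close> stands next to \<Omega>, and the
  outer factors can be pulled out.\<close>

lemma has_vector_derivative_congruence_matrix_exp:
  fixes \<Omega> L :: "real ^ 'n ^ 'n"
  defines "E \<equiv> \<lambda>t. matrix_exp (t *\<^sub>R L)"
  shows "((\<lambda>t. transpose (E t) ** \<Omega> ** E t) has_vector_derivative
    transpose (E t) ** (transpose L ** \<Omega> + \<Omega> ** L) ** E t) (at t within S)"
proof -
  interpret mult: bounded_bilinear "(**) :: real ^ 'n ^ 'n \<Rightarrow> real ^ 'n ^ 'n \<Rightarrow> real ^ 'n ^ 'n"
    by (rule bounded_bilinear_matrix_mult)
  have E: "(E has_vector_derivative L ** E t) (at t within S)"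
    unfolding E_def by (rule matrix_exp_has_vector_derivative)
  note * = mult.has_vector_derivative[OF mult.has_vector_derivative[OF
      bounded_linear.has_vector_derivative[OF bounded_linear_transpose E]
      has_vector_derivative_const] E]
  show ?thesis
    by (rule has_vector_derivative_eq_rhs[OF *[of \<Omega>]])
      (simp add: matrix_transpose_mul matrix_mul_assoc mult.add_left mult.add_right add.commute)
qed

lemma transpose_form_matrix:
  assumes "symplectic_form \<omega>"
  shows "transpose (form_matrix \<omega> b) = - form_matrix \<omega> b"
proof -
  have bil: "bilinear \<omega>" and alt: "\<omega> u u = 0" for u
    using assms by (auto simp: symplectic_form_def)
  have "\<omega> v u = - \<omega> u v" for u v
  proof -
    \<comment> \<open>Polarization: the left side and both squares on the right vanish because the
      form is alternating.\<close>
    have "\<omega> (u + v) (u + v) = \<omega> u u + \<omega> u v + (\<omega> v u + \<omega> v v)"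
      by (simp only: bilinear_ladd[OF bil] bilinear_radd[OF bil])
    then show ?thesis
      unfolding alt by linarith
  qed
  then have "\<omega> (b j) (b i) = - \<omega> (b i) (b j)" for i j
    by blast
  then show ?thesis
    unfolding form_matrix_def transpose_def vec_eq_iff uminus_vec_def vec_lambda_beta by blast
qed

text \<open>A kernel vector \<open>x\<close> of the transposed matrix lists the coordinates of a
  vector \<open>u\<close> that pairs to zero with the whole basis, so \<open>u = 0\<close> and
  \<open>x = 0\<close>. The transpose appears because non-degeneracy is stated for the first
  argument of the form.\<close>

lemma invertible_form_matrix:
  fixes b :: "'n::finite \<Rightarrow> 'v::real_vector"
  assumes "symplectic_form \<omega>" and "indexed_basis b"
  shows "invertible (form_matrix \<omega> b)"
proof -
  have bil: "bilinear \<omega>" and nondeg: "\<And>u. (\<And>v. \<omega> u v = 0) \<Longrightarrow> u = 0"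
    using assms(1) by (auto simp: symplectic_form_def)
  have b: "inj b" "independent (range b)" "span (range b) = UNIV"
    using assms(2) by (auto simp: indexed_basis_def)
  have "x = 0" if x: "transpose (form_matrix \<omega> b) *v x = 0" for x
  proof -
    define u where "u = (\<Sum>i\<in>UNIV. x $ i *\<^sub>R b i)"
    have linl: "linear (\<lambda>u. \<omega> u v)" for v
      using bil by (simp add: bilinear_def)
    have "\<omega> u (b j) = (transpose (form_matrix \<omega> b) *v x) $ j" for j
      by (simp add: u_def linear_sum[OF linl] bilinear_lmul[OF bil] form_matrix_def
          transpose_def matrix_vector_mult_def mult.commute)
    then have u_basis: "\<omega> u v = 0" if "v \<in> range b" for v
      using that x by auto
    have "linear (\<omega> u)"
      using bil by (simp add: bilinear_def)
    then have "\<omega> u v = 0" for v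
      using linear_eq_0_on_span[of "\<omega> u" "range b" v] u_basis b(3) by auto
    then have "u = 0"
      by (rule nondeg)
    \<comment> \<open>Independence concerns the set \<open>range b\<close>, so the sum is reindexed
      over it, with \<open>inv b\<close> recovering the index of each basis vector.\<close>
    then have "(\<Sum>v\<in>range b. x $ inv b v *\<^sub>R v) = 0"
      using b(1) by (simp add: u_def sum.reindex)
    then have "\<forall>v\<in>range b. x $ inv b v = 0"
      using b(2) by (auto simp: dependent_finite)
    then show "x = 0"
      using b(1) by (simp add: vec_eq_iff)
  qed
  then have "invertible (transpose (form_matrix \<omega> b))"
    by (simp add: invertible_left_inverse matrix_left_invertible_ker)
  then show ?thesis
    using transpose_invertible by fastforce
qed

lemma symplectic_lie_algebra_eq:
  assumes "symplectic_form \<omega>" and "indexed_basis b"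
  shows "symplectic_lie_algebra \<omega> b =
    {L. transpose L ** form_matrix \<omega> b + form_matrix \<omega> b ** L = 0}"
proof -
  define \<Omega> where "\<Omega> = form_matrix \<omega> b"
  define F where "F = (\<lambda>L t. transpose (matrix_exp (t *\<^sub>R L)) ** \<Omega> ** matrix_exp (t *\<^sub>R L))"
  have F0: "F L 0 = \<Omega>" for L
    by (simp add: F_def)
  note F_deriv = has_vector_derivative_congruence_matrix_exp[of _ \<Omega>, folded F_def]
  have group_iff: "B \<in> symplectic_group \<omega> b \<longleftrightarrow> transpose B ** \<Omega> ** B = \<Omega>" for B
  proof
    assume B: "transpose B ** \<Omega> ** B = \<Omega>"
    obtain \<Omega>' where "\<Omega>' ** \<Omega> = mat 1"
      using invertible_form_matrix[OF assms] unfolding \<Omega>_def invertible_def by blast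
    \<comment> \<open>Multiplying the congruence by a left inverse of \<Omega> exhibits a left
      inverse of \<open>B\<close>, which for a square matrix means invertibility. Membership in the
      group is thus the congruence alone.\<close>
    with B have "(\<Omega>' ** transpose B ** \<Omega>) ** B = mat 1"
      by (simp flip: matrix_mul_assoc)
    then have "invertible B"
      using invertible_left_inverse by blast
    with B show "B \<in> symplectic_group \<omega> b"
      by (simp add: symplectic_group_def general_linear_group_def \<Omega>_def)
  qed (simp add: symplectic_group_def \<Omega>_def)
  have "(\<forall>t. F L t = \<Omega>) \<longleftrightarrow> transpose L ** \<Omega> + \<Omega> ** L = 0" for L
  proof
    assume "\<forall>t. F L t = \<Omega>"
    then have "F L = (\<lambda>t. \<Omega>)"
      by auto
    \<comment> \<open>At \<open>t = 0\<close> the outer factors are the identity, so the derivative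
      is the bare expression in \<open>L\<close>.\<close>
    moreover have "(F L has_vector_derivative transpose L ** \<Omega> + \<Omega> ** L) (at 0)"
      using F_deriv[of L 0 UNIV] by (simp add: F_def)
    ultimately show "transpose L ** \<Omega> + \<Omega> ** L = 0"
      using vector_derivative_unique_at has_vector_derivative_const by metis
  next
    assume "transpose L ** \<Omega> + \<Omega> ** L = 0"
    \<comment> \<open>Here the middle factor vanishes, which makes the derivative zero at every
      \<open>t\<close> and not only at \<open>0\<close>.\<close>
    then have "(F L has_vector_derivative 0) (at t)" for t
      using F_deriv[of L t UNIV] by (simp add: F_def)
    then have "F L t = F L 0" for t
      using has_derivative_zero_unique[of UNIV "F L" t 0] by (simp add: has_vector_derivative_def)
    then show "\<forall>t. F L t = \<Omega>"
      by (simp add: F0)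
  qed
  then show ?thesis
    by (auto simp: symplectic_lie_algebra_def matrix_lie_algebra_def group_iff F_def simp flip: \<Omega>_def)
qed

text \<open>By skewness the first equation reads
  \<open>transpose L ** \<Omega> = transpose \<Omega> ** L\<close>. Multiplying on the left by the
  inverse of \<open>transpose \<Omega>\<close> gives the second, and multiplying back reverses the
  step.\<close>

lemma skew_matrix_adjoint_iff:
  fixes \<Omega> L :: "real ^ 'n ^ 'n"
  assumes "invertible \<Omega>" and skew: "transpose \<Omega> = - \<Omega>"
  shows "transpose L ** \<Omega> + \<Omega> ** L = 0 \<longleftrightarrow>
    transpose (matrix_inv \<Omega>) ** transpose L ** \<Omega> = L"
proof -
  interpret mult: bounded_bilinear "(**) :: real ^ 'n ^ 'n \<Rightarrow> real ^ 'n ^ 'n \<Rightarrow> real ^ 'n ^ 'n"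
    by (rule bounded_bilinear_matrix_mult)
  define P where "P = transpose (matrix_inv \<Omega>)"
  \<comment> \<open>\<open>matrix_inv\<close> chooses a two-sided inverse, and invertibility
    justifies the choice. Transposing both equations shows that \<open>P\<close> inverts
    \<open>transpose \<Omega>\<close>.\<close>
  have "\<Omega> ** matrix_inv \<Omega> = mat 1" "matrix_inv \<Omega> ** \<Omega> = mat 1"
    using someI_ex[OF assms(1)[unfolded invertible_def]] by (simp_all add: matrix_inv_def)
  then have P: "P ** transpose \<Omega> = mat 1" "transpose \<Omega> ** P = mat 1"
    by (metis P_def matrix_transpose_mul transpose_mat)+
  have "transpose L ** \<Omega> + \<Omega> ** L = 0 \<longleftrightarrow> transpose L ** \<Omega> = transpose \<Omega> ** L"
    by (simp add: skew mult.minus_left eq_neg_iff_add_eq_0)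
  also have "\<dots> \<longleftrightarrow> P ** (transpose L ** \<Omega>) = L"
    by (metis P matrix_mul_assoc matrix_mul_lid)
  finally show ?thesis
    by (simp add: P_def matrix_mul_assoc)
qed

theorem proposition3p4:
  fixes \<omega> :: "'v::real_vector \<Rightarrow> 'v \<Rightarrow> real"
    and b :: "'m::finite \<Rightarrow> 'v"
    and n :: nat
  assumes "symplectic_form \<omega>"
    and "indexed_basis b"
    and "CARD('m) = 2 * n"
  shows "symplectic_lie_algebra \<omega> b =
           {L. transpose L ** form_matrix \<omega> b + form_matrix \<omega> b ** L = 0} \<and>
         {L. transpose L ** form_matrix \<omega> b + form_matrix \<omega> b ** L = 0} =
           {L. transpose (matrix_inv (form_matrix \<omega> b)) ** transpose L ** form_matrix \<omega> b = L}"
  unfolding symplectic_lie_algebra_eq[OF assms(1,2)]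
    skew_matrix_adjoint_iff[OF invertible_form_matrix[OF assms(1,2)] transpose_form_matrix[OF assms(1)]]
  by blast

end
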